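(* Let $\Phi\in L^1(\mu)$. Then the operator $\mathbb{H}_{\Phi,\mu}$ with the domain $D$ is equal to a Carleman operator $\mathbb{K}_{\Phi,\mu}$ in $L^2(\mathbb{R})$. More precisely, for each $f\in D$ and $t\in\mathbb{R}$, $$(\mathbb{H}_{\Phi,\mu}f)(t)=\int_{-\infty}^\infty K_{\Phi,\mu}(t,x)f(x)\,dx,$$ where $$K_{\Phi,\mu}(t,x)=\int_0^\infty\Phi(u)\,\mathrm{sinc}\left(\frac tu-x\right)d\mu(u)$$ is a Carleman kernel.
   Context: $\mu$ is a regular positive Borel measure on $(0,\infty)$ and $\Phi:(0,\infty)\to\mathbb{C}$ is $\mu$-measurable. The Hausdorff operator is $(\mathbb{H}_{\Phi,\mu}F)(z)=\int_0^\infty \Phi(u)F(z/u)\,d\mu(u)$. $\mathrm{sinc}(z):=\frac{\sin(\pi z)}{\pi z}$, with $\mathrm{sinc}(0)=1$. $D:=\{f: f=\widehat\psi,\ \psi\in C^2(\mathbb{R}),\ \mathrm{supp}(\psi)\subset[-\pi,\pi]\}$, where the hat is the Fourier transform, $\widehat\psi(x)=\frac1{\sqrt{2\pi}}\int\psi(s)e^{-isx}ds$ (normalization immaterial for $D$). An operator $T$ from $L^2(M_1)$ into $L^2(M_2)$ ($M_1,M_2$ measure spaces), with domain $\mathrm{dom}(T)$, is a Carleman operator if there is a measurable function $K:M_2\times M_1\to\mathbb{C}$ such that $K(x,\cdot)\in L^2(M_1)$ for almost every $x\in M_2$ and $(Tf)(x)=\int_{M_1}K(x,y)f(y)\,dy$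 for almost every $x\in M_2$, for each $f\in\mathrm{dom}(T)$. Such a kernel $K$ is called a Carleman kernel.
   Formalization: H need not map D into L²(R) (e.g. dμ=du, Φ(u)=u^(-1-e) for u≥1, 0<e<1/2), so "Carleman operator in L²(R)" is asserted on the domain of those f in D with Hf in L²(R); the integral formula for all f in D, all t, and the Carleman kernel claim are kept in full. *)

theory Defs
  imports "HOL-Analysis.Analysis"
begin

text \<open>Finiteness on compact sets is deliberately not required; on \<open>{0<..}\<close> it
  would by itself imply both regularity conditions.\<close>

definition regular_borel_measure_on :: "'a::topological_space set \<Rightarrow> 'a measure \<Rightarrow> bool" where
  "regular_borel_measure_on X M \<longleftrightarrow>
     sets M = sets (restrict_space borel X) \<and>
     (\<forall>A\<in>sets M.
        emeasure M A = (INF U\<in>{U. openin (top_of_set X) U \<and> A \<subseteq> U}. emeasure M U) \<and>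
        emeasure M A = (SUP C\<in>{C. compact C \<and> C \<subseteq> A}. emeasure M C))"

definition square_integrable :: "'a measure \<Rightarrow> ('a \<Rightarrow> complex) \<Rightarrow> bool" where
  "square_integrable M f \<longleftrightarrow>
     f \<in> borel_measurable M \<and> integrable M (\<lambda>x. (cmod (f x))\<^sup>2)"

text \<open>Elements of \<open>L\<^sup>2\<close> are handled through representatives: a linear operator
  acts on a linear space \<open>S\<close> of square-integrable functions and must respect
  almost-everywhere equality.\<close>

definition L2_operator ::
  "'a measure \<Rightarrow> 'b measure \<Rightarrow> ('a \<Rightarrow> complex) set \<Rightarrow> (('a \<Rightarrow> complex) \<Rightarrow> 'b \<Rightarrow> complex) \<Rightarrow> bool" where
  "L2_operator M1 M2 S T \<longleftrightarrow>
     (\<forall>f\<in>S. square_integrable M1 f \<and> square_integrable M2 (T f)) \<and>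
     (\<lambda>_. 0) \<in> S \<and>
     (\<forall>f\<in>S. \<forall>g\<in>S. \<forall>a b.
        (\<lambda>x. a * f x + b * g x) \<in> S \<and>
        (AE y in M2. T (\<lambda>x. a * f x + b * g x) y = a * T f y + b * T g y)) \<and>
     (\<forall>f\<in>S. \<forall>g\<in>S. (AE x in M1. f x = g x) \<longrightarrow> (AE y in M2. T f y = T g y))"

definition carleman_kernel :: "'a measure \<Rightarrow> 'b measure \<Rightarrow> ('b \<Rightarrow> 'a \<Rightarrow> complex) \<Rightarrow> bool" where
  "carleman_kernel M1 M2 K \<longleftrightarrow>
     (\<lambda>(x, y). K x y) \<in> borel_measurable (M2 \<Otimes>\<^sub>M M1) \<and>
     (AE x in M2. square_integrable M1 (K x))"

definition carleman_operator ::
  "'a measure \<Rightarrow> 'b measure \<Rightarrow> ('a \<Rightarrow> complex) set \<Rightarrow> (('a \<Rightarrow> complex) \<Rightarrow> 'b \<Rightarrow> complex) \<Rightarrow> bool" where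
  "carleman_operator M1 M2 S T \<longleftrightarrow>
     L2_operator M1 M2 S T \<and>
     (\<exists>K. carleman_kernel M1 M2 K \<and>
          (\<forall>f\<in>S. AE x in M2. T f x = (LINT y|M1. K x y * f y)))"

text \<open>The completion lets \<open>\<Phi>\<close> be \<open>\<mu>\<close>-measurable, not necessarily Borel.\<close>

definition hausdorff_op ::
  "(real \<Rightarrow> complex) \<Rightarrow> real measure \<Rightarrow> (real \<Rightarrow> complex) \<Rightarrow> real \<Rightarrow> complex" where
  "hausdorff_op \<Phi> \<mu> F z = (LINT u|completion \<mu>. \<Phi> u * F (z / u))"

definition nsinc :: "real \<Rightarrow> real" where
  "nsinc x = (if x = 0 then 1 else sin (pi * x) / (pi * x))"

definition hausdorff_kernel ::
  "(real \<Rightarrow> complex) \<Rightarrow> real measure \<Rightarrow> real \<Rightarrow> real \<Rightarrow> complex" where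
  "hausdorff_kernel \<Phi> \<mu> t x =
     (LINT u|completion \<mu>. \<Phi> u * complex_of_real (nsinc (t / u - x)))"

definition C2_on_reals :: "(real \<Rightarrow> complex) \<Rightarrow> bool" where
  "C2_on_reals \<psi> \<longleftrightarrow>
     (\<exists>\<psi>'. (\<forall>s. (\<psi> has_vector_derivative \<psi>' s) (at s)) \<and> \<psi>' C1_differentiable_on UNIV)"

definition fourier_transform :: "(real \<Rightarrow> complex) \<Rightarrow> real \<Rightarrow> complex" where
  "fourier_transform \<psi> x =
     complex_of_real (1 / sqrt (2 * pi)) *
     (LINT s|lborel. \<psi> s * exp (- (\<i> * complex_of_real s * complex_of_real x)))"

definition bandlimited_D :: "(real \<Rightarrow> complex) set" where
  "bandlimited_D =
     {fourier_transform \<psi> |\<psi>. C2_on_reals \<psi> \<and> closure {s. \<psi> s \<noteq> 0} \<subseteq> {- pi..pi}}"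

end

theory Submission
  imports Defs "HOL-Probability.Characteristic_Functions" "HOL-Probability.Sinc_Integral"
begin

text \<open>A function \<open>f\<close> in the domain is the Fourier transform of a \<open>C\<^sup>2\<close> function \<open>\<psi>\<close> supported in
  \<open>{- pi..pi}\<close>. Convolution with sinc multiplies the spectrum by the indicator of that interval,
  so it reproduces \<open>f\<close>: the value \<open>f t\<close> is the integral of \<open>nsinc (t - x) * f x\<close> over \<open>x\<close>
  (\<open>bandlimited_reproducing\<close>). Inserting this at \<open>t / u\<close> into the Hausdorff integral and
  exchanging the order of integration yields exactly the integral of the kernel against \<open>f\<close>.

  Three points need work. The reproducing formula rests on Fourier inversion
  (\<open>fourier_inversion\<close>), obtained by Gaussian regularisation from the characteristic function of
  the normal distribution. Inversion and the exchange of integrals require \<open>f\<close> to be integrable;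
  integrating by parts twice shows that \<open>f\<close> decays like \<open>1 / (1 + x\<^sup>2)\<close>
  (\<open>bandlimited_D_elim\<close>). Finally, \<open>\<mu>\<close> may fail to be \<open>\<sigma>\<close>-finite, so Fubini's theorem is
  applied to the finite measure with density \<open>cmod (\<Phi> u)\<close>, the phase of \<open>\<Phi>\<close> staying in the
  integrand (\<open>integral_density_norm\<close>). Over this finite measure the Cauchy-Schwarz inequality
  and the translation invariance of the \<open>L\<^sup>2\<close> norm of sinc also show that every row of the kernel is square integrable
  (\<open>kernel_average_square_integrable\<close>).\<close>

section \<open>Products of integrable functions with a bounded kernel\<close>

text \<open>Every interchange of integrals below has this shape: the integrand is dominated by
  the tensor product of two integrable functions. Only the kernel \<open>k\<close> varies: an exponential
  in the inversion and reproducing formulas, a shifted sinc for the Hausdorff operator.\<close>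

lemma Fubini_bounded_kernel:
  fixes f :: "'a \<Rightarrow> complex" and g :: "'b \<Rightarrow> complex" and k :: "'a \<Rightarrow> 'b \<Rightarrow> complex"
  assumes "sigma_finite_measure M1" and "sigma_finite_measure M2"
    and f: "integrable M1 f" and g: "integrable M2 g"
    and k[measurable]: "(\<lambda>(x, y). k x y) \<in> borel_measurable (M1 \<Otimes>\<^sub>M M2)"
    and k_le: "\<And>x y. cmod (k x y) \<le> 1"
  shows "(\<integral>x. f x * (\<integral>y. k x y * g y \<partial>M2) \<partial>M1) = (\<integral>y. (\<integral>x. f x * k x y \<partial>M1) * g y \<partial>M2)"
    and "integrable M2 (\<lambda>y. (\<integral>x. f x * k x y \<partial>M1) * g y)"
proof -
  interpret pair_sigma_finite M1 M2
    using assms(1,2) by (simp add: pair_sigma_finite_def)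
  have [measurable]: "f \<in> borel_measurable M1" "g \<in> borel_measurable M2"
    using f g by auto
  let ?h = "\<lambda>x y. f x * k x y * g y"
  have int_prod: "integrable (M1 \<Otimes>\<^sub>M M2) (\<lambda>(x, y). f x * g y)"
  proof (rule Fubini_integrable)
    show "integrable M1 (\<lambda>x. \<integral>y. norm (case (x, y) of (x, y) \<Rightarrow> f x * g y) \<partial>M2)"
      using f by (simp add: norm_mult)
  qed (use g in auto)
  have int_h: "integrable (M1 \<Otimes>\<^sub>M M2) (\<lambda>(x, y). ?h x y)"
  proof (rule Bochner_Integration.integrable_bound[OF int_prod])
    show "AE p in M1 \<Otimes>\<^sub>M M2. norm (case p of (x, y) \<Rightarrow> ?h x y) \<le> norm (case p of (x, y) \<Rightarrow> f x * g y)"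
      using k_le by (intro AE_I2)
        (auto simp: norm_mult split: prod.split intro!: mult_right_mono mult_left_le)
  qed measurable
  show "(\<integral>x. f x * (\<integral>y. k x y * g y \<partial>M2) \<partial>M1) = (\<integral>y. (\<integral>x. f x * k x y \<partial>M1) * g y \<partial>M2)"
    using Fubini_integral[OF int_h]
    by (simp add: mult.assoc flip: integral_mult_right_zero integral_mult_left_zero)
  show "integrable M2 (\<lambda>y. (\<integral>x. f x * k x y \<partial>M1) * g y)"
    using integrable_snd[OF int_h] by simp
qed

section \<open>Fourier inversion\<close>

lemma cmod_exp_i_real [simp]:
  "cmod (exp (\<i> * complex_of_real s * complex_of_real x)) = 1"
  "cmod (exp (- (\<i> * complex_of_real s * complex_of_real x))) = 1"
  by (simp_all add: norm_exp_eq_Re)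

lemma fourier_transform_measurable [measurable]:
  assumes [measurable]: "\<psi> \<in> borel_measurable borel"
  shows "fourier_transform \<psi> \<in> borel_measurable borel"
  unfolding fourier_transform_def[abs_def] by measurable

text \<open>The substitution \<open>r = s + e * v\<close>. The dilation by \<open>1 / e\<close> moves to the
  transform, where it will cancel against the change of variables in the Gaussian weight.\<close>

lemma fourier_transform_affine:
  assumes e: "e > 0"
  shows "(\<integral>v. exp (- (\<i> * complex_of_real v * complex_of_real x)) * \<psi> (s + e * v) \<partial>lborel) =
    complex_of_real (sqrt (2 * pi) / e) * exp (\<i> * complex_of_real s * complex_of_real (x / e))
      * fourier_transform \<psi> (x / e)"
proof -
  let ?h = "\<lambda>r. \<psi> r * exp (- (\<i> * complex_of_real r * complex_of_real (x / e)))"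
  have "(\<integral>r. ?h r \<partial>lborel) = e *\<^sub>R (\<integral>v. ?h (s + e * v) \<partial>lborel)"
    using lborel_integral_real_affine[of e ?h s] e by simp
  also have "(\<integral>v. ?h (s + e * v) \<partial>lborel) =
     (\<integral>v. exp (- (\<i> * complex_of_real s * complex_of_real (x / e))) *
        (exp (- (\<i> * complex_of_real v * complex_of_real x)) * \<psi> (s + e * v)) \<partial>lborel)"
  proof (intro Bochner_Integration.integral_cong refl)
    fix v
    have "- (\<i> * complex_of_real (s + e * v) * complex_of_real (x / e)) =
       - (\<i> * complex_of_real s * complex_of_real (x / e)) + - (\<i> * complex_of_real v * complex_of_real x)"
      using e by (simp add: field_simps)
    then show "?h (s + e * v) = exp (- (\<i> * complex_of_real s * complex_of_real (x / e))) *
        (exp (- (\<i> * complex_of_real v * complex_of_real x)) * \<psi> (s + e * v))"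
      by (simp only: exp_add mult_ac)
  qed
  also have "\<dots> = exp (- (\<i> * complex_of_real s * complex_of_real (x / e))) *
      (\<integral>v. exp (- (\<i> * complex_of_real v * complex_of_real x)) * \<psi> (s + e * v) \<partial>lborel)"
    by simp
  finally show ?thesis
    using e unfolding fourier_transform_def
    by (simp add: exp_minus scaleR_conv_of_real field_simps)
qed

text \<open>This is the characteristic function of the standard normal distribution at \<open>- v\<close>. It is
  used from right to left, to write a Gaussian weight as a Fourier integral.\<close>

lemma integral_normal_exp:
  "(\<integral>x. complex_of_real (std_normal_density x) * exp (- (\<i> * complex_of_real v * complex_of_real x)) \<partial>lborel)
    = complex_of_real (exp (- v\<^sup>2 / 2))"
proof -
  have "char std_normal_distribution (- v) = 
     (\<integral>x. std_normal_density x *\<^sub>R iexp (- v * x) \<partial>lborel)"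
    unfolding char_def by (subst integral_density) auto
  then show ?thesis
    by (simp add: char_std_normal_distribution scaleR_conv_of_real mult.assoc)
qed

text \<open>Writing the Gaussian weight as a Fourier integral and exchanging the integrals turns
  a Gaussian average of \<open>\<psi>\<close> at scale \<open>e\<close> around \<open>s\<close> into the inversion integral damped by a
  Gaussian of width \<open>1 / e\<close>.\<close>

lemma gaussian_mean_eq:
  assumes e: "e > 0" and \<psi>: "integrable lborel \<psi>"
  shows "(\<integral>v. complex_of_real (exp (- v\<^sup>2 / 2)) * \<psi> (s + e * v) \<partial>lborel) =
    (\<integral>y. complex_of_real (exp (- (e * y)\<^sup>2 / 2)) *
        (exp (\<i> * complex_of_real s * complex_of_real y) * fourier_transform \<psi> y) \<partial>lborel)"
proof -
  let ?E = "\<lambda>x v. exp (- (\<i> * complex_of_real v * complex_of_real x))"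
  let ?n = "\<lambda>x. complex_of_real (std_normal_density x)"
  let ?h = "\<lambda>y. complex_of_real (exp (- (e * y)\<^sup>2 / 2)) *
        (exp (\<i> * complex_of_real s * complex_of_real y) * fourier_transform \<psi> y)"
  have int_\<psi>: "integrable lborel (\<lambda>v. \<psi> (s + e * v))"
    using lborel_integrable_real_affine[OF \<psi>, of e s] e by simp
  have "(\<integral>v. complex_of_real (exp (- v\<^sup>2 / 2)) * \<psi> (s + e * v) \<partial>lborel) =
      (\<integral>v. (\<integral>x. ?n x * ?E x v \<partial>lborel) * \<psi> (s + e * v) \<partial>lborel)"
    by (simp only: integral_normal_exp)
  also have "\<dots> = (\<integral>x. ?n x * (\<integral>v. ?E x v * \<psi> (s + e * v) \<partial>lborel) \<partial>lborel)"
    by (intro Fubini_bounded_kernel(1)[symmetric] int_\<psi>)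
      (auto simp: sigma_finite_lborel)
  also have "\<dots> = (\<integral>x. (1 / e) *\<^sub>R ?h (0 + (1 / e) * x) \<partial>lborel)"
    unfolding fourier_transform_affine[OF e] using e
    by (intro Bochner_Integration.integral_cong refl)
      (simp add: std_normal_density_def scaleR_conv_of_real field_simps)
  also have "\<dots> = (\<integral>y. ?h y \<partial>lborel)"
    using lborel_integral_real_affine[of "1/e" ?h 0] e by simp
  finally show ?thesis .
qed

text \<open>As \<open>e\<close> tends to 0 in \<open>gaussian_mean_eq\<close>, the averages concentrate at \<open>s\<close> (by
  continuity and boundedness of \<open>\<psi>\<close>) while the damping factor tends to 1 (dominated by the
  integrable transform). The constant is the mass of the Gaussian.\<close>

theorem fourier_inversion:
  assumes \<psi>: "integrable lborel \<psi>" and cont: "continuous_on UNIV \<psi>"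
    and bound: "\<And>s. cmod (\<psi> s) \<le> B"
    and f: "integrable lborel (fourier_transform \<psi>)"
  shows "(\<integral>x. fourier_transform \<psi> x * exp (\<i> * complex_of_real s * complex_of_real x) \<partial>lborel)
    = complex_of_real (sqrt (2 * pi)) * \<psi> s"
proof -
  have [measurable]: "\<psi> \<in> borel_measurable borel"
    using \<psi> by auto
  have eps: "(\<lambda>n. 1 / real (Suc n)) \<longlonglongrightarrow> 0"
    using LIMSEQ_inverse_real_of_nat by (simp add: inverse_eq_divide)
  have int_gauss: "integrable lborel (\<lambda>v. exp (- v\<^sup>2 / 2) :: real)"
  proof -
    have "integrable lborel (\<lambda>v. sqrt (2 * pi) * std_normal_density v)"
      by (intro integrable_mult_right integrable_normal_density) simp
    then show ?thesis
      by (simp add: std_normal_density_def del: integrable_mult_right_iff)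
  qed
  have gauss: "(\<integral>v. exp (- v\<^sup>2 / 2) \<partial>lborel) = sqrt (2 * pi)"
  proof -
    have "(\<integral>v. exp (- v\<^sup>2 / 2) \<partial>lborel) = (\<integral>v. sqrt (2 * pi) * std_normal_density v \<partial>lborel)"
      by (intro Bochner_Integration.integral_cong) (simp_all add: std_normal_density_def)
    then show ?thesis by simp
  qed
  have lim1: "(\<lambda>n. \<integral>v. complex_of_real (exp (- v\<^sup>2 / 2)) * \<psi> (s + (1 / real (Suc n)) * v) \<partial>lborel)
     \<longlonglongrightarrow> (\<integral>v. complex_of_real (exp (- v\<^sup>2 / 2)) * \<psi> s \<partial>lborel)"
  proof (rule integral_dominated_convergence[where w = "\<lambda>v. exp (- v\<^sup>2 / 2) * B"])
    show "integrable lborel (\<lambda>v. exp (- v\<^sup>2 / 2) * B)"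
      using int_gauss by simp
    show "AE v in lborel. (\<lambda>n. complex_of_real (exp (- v\<^sup>2 / 2)) * \<psi> (s + (1 / real (Suc n)) * v))
        \<longlonglongrightarrow> complex_of_real (exp (- v\<^sup>2 / 2)) * \<psi> s"
    proof (rule AE_I2)
      fix v :: real
      have "(\<lambda>n. s + (1 / real (Suc n)) * v) \<longlonglongrightarrow> s + 0 * v"
        by (intro tendsto_intros eps)
      then have "(\<lambda>n. \<psi> (s + (1 / real (Suc n)) * v)) \<longlonglongrightarrow> \<psi> s"
        using cont by (intro isCont_tendsto_compose[of s \<psi>]) (auto simp: continuous_on_eq_continuous_at)
      then show "(\<lambda>n. complex_of_real (exp (- v\<^sup>2 / 2)) * \<psi> (s + (1 / real (Suc n)) * v))
        \<longlonglongrightarrow> complex_of_real (exp (- v\<^sup>2 / 2)) * \<psi> s"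
        by (intro tendsto_intros)
    qed
  qed (auto simp: norm_mult bound)
  have lim2: "(\<lambda>n. \<integral>y. complex_of_real (exp (- (1 / real (Suc n) * y)\<^sup>2 / 2)) *
        (exp (\<i> * complex_of_real s * complex_of_real y) * fourier_transform \<psi> y) \<partial>lborel)
     \<longlonglongrightarrow> (\<integral>y. exp (\<i> * complex_of_real s * complex_of_real y) * fourier_transform \<psi> y \<partial>lborel)"
  proof (rule integral_dominated_convergence[where w = "\<lambda>y. cmod (fourier_transform \<psi> y)"])
    show "AE y in lborel. (\<lambda>n. complex_of_real (exp (- (1 / real (Suc n) * y)\<^sup>2 / 2)) *
        (exp (\<i> * complex_of_real s * complex_of_real y) * fourier_transform \<psi> y))
       \<longlonglongrightarrow> exp (\<i> * complex_of_real s * complex_of_real y) * fourier_transform \<psi> y"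
    proof (rule AE_I2)
      fix y :: real
      have "(\<lambda>n. complex_of_real (exp (- (1 / real (Suc n) * y)\<^sup>2 / 2)) *
        (exp (\<i> * complex_of_real s * complex_of_real y) * fourier_transform \<psi> y))
       \<longlonglongrightarrow> complex_of_real (exp (- (0 * y)\<^sup>2 / 2)) *
        (exp (\<i> * complex_of_real s * complex_of_real y) * fourier_transform \<psi> y)"
        by (intro tendsto_intros eps) auto
      then show "(\<lambda>n. complex_of_real (exp (- (1 / real (Suc n) * y)\<^sup>2 / 2)) *
        (exp (\<i> * complex_of_real s * complex_of_real y) * fourier_transform \<psi> y))
       \<longlonglongrightarrow> exp (\<i> * complex_of_real s * complex_of_real y) * fourier_transform \<psi> y"
        by simp
    qed
    show "AE y in lborel. norm (complex_of_real (exp (- (1 / real (Suc n) * y)\<^sup>2 / 2)) *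
        (exp (\<i> * complex_of_real s * complex_of_real y) * fourier_transform \<psi> y))
        \<le> cmod (fourier_transform \<psi> y)" for n
      by (intro AE_I2) (auto simp: norm_mult intro!: mult_left_le_one_le)
  qed (use f in auto)
  have "(\<integral>y. exp (\<i> * complex_of_real s * complex_of_real y) * fourier_transform \<psi> y \<partial>lborel)
      = (\<integral>v. complex_of_real (exp (- v\<^sup>2 / 2)) * \<psi> s \<partial>lborel)"
    using lim1 lim2 LIMSEQ_unique by (subst (asm) gaussian_mean_eq[OF _ \<psi>]) auto
  also have "\<dots> = complex_of_real (sqrt (2 * pi)) * \<psi> s"
    using gauss by simp
  finally show ?thesis
    by (simp add: mult.commute)
qed

section \<open>Decay of transforms of smooth compactly supported functions\<close>

lemma integrable_lborel_if_support_bounded: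
  fixes g :: "real \<Rightarrow> complex"
  assumes cont: "continuous_on UNIV g" and supp: "\<And>s. s \<notin> {a..b} \<Longrightarrow> g s = 0"
  shows "integrable lborel g"
proof -
  have "integrable lborel (\<lambda>s. indicator {a..b} s *\<^sub>R g s)"
    using borel_integrable_atLeastAtMost'[OF continuous_on_subset[OF cont], of a b]
    by (simp add: set_integrable_def)
  moreover have "(\<lambda>s. indicator {a..b} s *\<^sub>R g s) = g"
    using supp by (auto simp: fun_eq_iff indicator_def)
  ultimately show ?thesis by simp
qed

lemma cmod_fourier_transform_le:
  "cmod (fourier_transform g x) \<le> (\<integral>s. cmod (g s) \<partial>lborel)"
proof -
  have "1 \<le> sqrt (2 * pi)"
    using pi_ge_two by (simp add: real_le_rsqrt)
  then have "cmod (fourier_transform g x) \<le>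
      cmod (\<integral>s. g s * exp (- (\<i> * complex_of_real s * complex_of_real x)) \<partial>lborel)"
    unfolding fourier_transform_def norm_mult
    by (intro mult_left_le_one_le) (auto simp del: of_real_divide)
  also have "\<dots> \<le> (\<integral>s. cmod (g s * exp (- (\<i> * complex_of_real s * complex_of_real x))) \<partial>lborel)"
    by (rule integral_norm_bound)
  finally show ?thesis by (simp add: norm_mult)
qed

lemma derivative_zero_outside:
  fixes g :: "real \<Rightarrow> complex"
  assumes g: "\<And>s. (g has_vector_derivative g' s) (at s)"
    and supp: "\<And>s. s \<notin> {a..b} \<Longrightarrow> g s = 0" and s: "s \<notin> {a..b}"
  shows "g' s = 0"
proof -
  have "(g has_vector_derivative 0) (at s)"
  proof (rule has_vector_derivative_transform_within_open)
    show "((\<lambda>_. 0) has_vector_derivative 0) (at s)" by simp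
    show "open (- {a..b})" by auto
  qed (use s supp in auto)
  then show ?thesis
    using g vector_derivative_unique_at by blast
qed

text \<open>Integration by parts. The interval of integration is enlarged by 1 on both sides so that its
  end points lie where \<open>g\<close> is zero by hypothesis and the boundary terms vanish. Taking minimum and
  maximum covers the case \<open>a > b\<close>.\<close>

lemma fourier_transform_derivative:
  fixes g :: "real \<Rightarrow> complex"
  assumes g: "\<And>s. (g has_vector_derivative g' s) (at s)" and g': "continuous_on UNIV g'"
    and supp: "\<And>s. s \<notin> {a..b} \<Longrightarrow> g s = 0"
  shows "fourier_transform g' x = \<i> * complex_of_real x * fourier_transform g x"
proof -
  let ?e = "\<lambda>s. exp (- (\<i> * complex_of_real s * complex_of_real x))"
  let ?d = "\<lambda>s. g' s * ?e s + g s * (- (\<i> * complex_of_real x) * ?e s)"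
  have supp': "g' s = 0" if "s \<notin> {a..b}" for s
    using derivative_zero_outside[OF g supp that] .
  have cont: "continuous_on UNIV g"
    using g by (auto intro!: continuous_at_imp_continuous_on has_vector_derivative_continuous)
  have int: "integrable lborel (\<lambda>s. g s * ?e s)" "integrable lborel (\<lambda>s. g' s * ?e s)"
    by (rule integrable_lborel_if_support_bounded[of _ a b];
        auto intro!: continuous_intros cont g' simp: supp supp')+
  have de: "(?e has_vector_derivative - (\<i> * complex_of_real x) * ?e s) (at s within A)" for s A
    unfolding has_vector_derivative_complex_iff
    by (auto intro!: derivative_eq_intros simp: Re_exp Im_exp)
  have "(\<integral>s. ?d s \<partial>lborel) = (\<integral>s. indicator {min a b - 1..max a b + 1} s *\<^sub>R ?d s \<partial>lborel)"
  proof (intro Bochner_Integration.integral_cong refl)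
    fix s
    have "s \<in> {min a b - 1..max a b + 1}" if "s \<in> {a..b}"
      using that by auto
    then show "?d s = indicator {min a b - 1..max a b + 1} s *\<^sub>R ?d s"
      using supp[of s] supp'[of s] by (cases "s \<in> {a..b}") (auto simp: indicator_def)
  qed
  also have "\<dots> = g (max a b + 1) * ?e (max a b + 1) - g (min a b - 1) * ?e (min a b - 1)"
  proof (rule integral_FTC_atLeastAtMost)
    show "((\<lambda>s. g s * ?e s) has_vector_derivative ?d s)
        (at s within {min a b - 1..max a b + 1})" for s
      using has_vector_derivative_mult[OF has_vector_derivative_at_within[OF g] de]
      by (simp add: algebra_simps)
    show "continuous_on {min a b - 1..max a b + 1} ?d"
      by (intro continuous_intros continuous_on_subset[OF cont] continuous_on_subset[OF g']) auto
  qed auto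
  also have "\<dots> = 0"
  proof -
    have "max a b + 1 \<notin> {a..b}" "min a b - 1 \<notin> {a..b}" by auto
    then show ?thesis using supp by (metis diff_zero mult_zero_left)
  qed
  finally have "(\<integral>s. g' s * ?e s \<partial>lborel) - \<i> * complex_of_real x * (\<integral>s. g s * ?e s \<partial>lborel) = 0"
    using int by (simp add: algebra_simps)
  then show ?thesis
    by (simp add: fourier_transform_def)
qed

lemma integrable_lborel_inverse_1_plus_square: "integrable lborel (\<lambda>x::real. inverse (1 + x\<^sup>2))"
  using integrable_inverse_1_plus_square by (simp add: set_integrable_def einterval_eq)

text \<open>Two integrations by parts identify \<open>- x\<^sup>2 * f x\<close> with the transform of the second
  derivative of \<open>\<psi>\<close>. Both this product and \<open>f\<close> are bounded by the integrals of the moduli of the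
  functions transformed, and adding the two bounds gives the decay.\<close>

lemma bandlimited_D_elim:
  assumes "f \<in> bandlimited_D"
  obtains \<psi> B C where "f = fourier_transform \<psi>" "continuous_on UNIV \<psi>" "\<And>s. s \<notin> {- pi..pi} \<Longrightarrow> \<psi> s = 0"
    "\<And>s. cmod (\<psi> s) \<le> B" "\<And>x. cmod (f x) \<le> C * inverse (1 + x\<^sup>2)"
proof -
  obtain \<psi> where f: "f = fourier_transform \<psi>" and C2: "C2_on_reals \<psi>"
    and cl: "closure {s. \<psi> s \<noteq> 0} \<subseteq> {- pi..pi}"
    using assms unfolding bandlimited_D_def by blast
  from C2 obtain \<psi>' \<psi>'' where d1: "\<And>s. (\<psi> has_vector_derivative \<psi>' s) (at s)"
    and d2: "\<And>s. (\<psi>' has_vector_derivative \<psi>'' s) (at s)" and cont2: "continuous_on UNIV \<psi>''"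
    unfolding C2_on_reals_def C1_differentiable_on_def by blast
  have supp: "\<psi> s = 0" if "s \<notin> {- pi..pi}" for s
    using cl closure_subset[of "{s. \<psi> s \<noteq> 0}"] that by blast
  have supp1: "\<psi>' s = 0" if "s \<notin> {- pi..pi}" for s
    using derivative_zero_outside[OF d1 supp that] .
  have cont: "continuous_on UNIV \<psi>" and cont1: "continuous_on UNIV \<psi>'"
    using d1 d2 by (auto intro!: continuous_at_imp_continuous_on has_vector_derivative_continuous)
  have "bounded (\<psi> ` {- pi..pi})"
    by (intro compact_imp_bounded compact_continuous_image continuous_on_subset[OF cont]) auto
  then obtain B where B: "\<And>s. s \<in> {- pi..pi} \<Longrightarrow> cmod (\<psi> s) \<le> B" "B > 0"
    unfolding bounded_pos by blast
  have bound: "cmod (\<psi> s) \<le> B" for s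
    using B supp[of s] by (cases "s \<in> {- pi..pi}") auto
  let ?C = "(\<integral>s. cmod (\<psi> s) \<partial>lborel) + (\<integral>s. cmod (\<psi>'' s) \<partial>lborel)"
  have "cmod (f x) \<le> ?C * inverse (1 + x\<^sup>2)" for x
  proof -
    have i_square: "\<i> * z * (\<i> * z * w) = - (z * z * w)" for z w
    proof -
      have "\<i> * z * (\<i> * z * w) = (\<i> * \<i>) * (z * z * w)" by (simp only: mult_ac)
      then show ?thesis by simp
    qed
    have "fourier_transform \<psi>'' x = - (complex_of_real (x\<^sup>2)) * f x"
      using fourier_transform_derivative[OF d2 cont2, of "- pi" pi x] supp1
        fourier_transform_derivative[OF d1 cont1, of "- pi" pi x] supp
      by (simp add: f power2_eq_square i_square)
    then have "cmod (f x) * x\<^sup>2 = cmod (fourier_transform \<psi>'' x)"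
      by (simp add: norm_mult norm_power)
    then have "cmod (f x) * (1 + x\<^sup>2) \<le> ?C"
      using cmod_fourier_transform_le[of \<psi>'' x] cmod_fourier_transform_le[of \<psi> x]
      by (simp add: f distrib_left)
    moreover have "0 < 1 + x\<^sup>2" by (simp add: add_pos_nonneg)
    ultimately show ?thesis by (simp add: field_simps)
  qed
  then show thesis
    using f cont supp bound that by blast
qed

text \<open>Boundedness makes the Hausdorff integrals converge, integrability permits the
  interchange of integrals and the inversion formula.\<close>

lemma bandlimited_D_integrable:
  assumes "f \<in> bandlimited_D"
  shows "f \<in> borel_measurable borel" "integrable lborel f" "square_integrable lborel f"
    "\<exists>B. \<forall>x. cmod (f x) \<le> B"
proof -
  obtain \<psi> B C where f: "f = fourier_transform \<psi>" and cont: "continuous_on UNIV \<psi>"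
    and le: "\<And>x. cmod (f x) \<le> C * inverse (1 + x\<^sup>2)"
    using bandlimited_D_elim[OF assms] by metis
  have [measurable]: "\<psi> \<in> borel_measurable borel"
    using cont by (rule borel_measurable_continuous_onI)
  show m[measurable]: "f \<in> borel_measurable borel"
    unfolding f by measurable
  show int: "integrable lborel f"
  proof (rule Bochner_Integration.integrable_bound)
    show "integrable lborel (\<lambda>x. C * inverse (1 + x\<^sup>2))"
      by (intro integrable_mult_right integrable_lborel_inverse_1_plus_square)
    show "AE x in lborel. norm (f x) \<le> norm (C * inverse (1 + x\<^sup>2))"
      using le by (intro AE_I2) (metis abs_ge_self order_trans real_norm_def)
  qed simp
  have C: "0 \<le> C"
    using le[of 0] norm_ge_zero[of "f 0"] by (simp del: norm_ge_zero)
  have B: "cmod (f x) \<le> C" for x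
    using le[of x] C mult_left_le[of "inverse (1 + x\<^sup>2)" C]
    by (simp add: inverse_le_1_iff)
  then show "\<exists>B. \<forall>x. cmod (f x) \<le> B" by blast
  have "integrable lborel (\<lambda>x. (cmod (f x))\<^sup>2)"
  proof (rule Bochner_Integration.integrable_bound)
    show "integrable lborel (\<lambda>x. C * cmod (f x))" using int by simp
    show "AE x in lborel. norm ((cmod (f x))\<^sup>2) \<le> norm (C * cmod (f x))"
      using B C by (intro AE_I2) (simp add: power2_eq_square mult_right_mono)
  qed simp
  then show "square_integrable lborel f"
    by (simp add: square_integrable_def)
qed

section \<open>The sinc function and the reproducing formula\<close>

lemma nsinc_measurable [measurable]: "nsinc \<in> borel_measurable borel"
  unfolding nsinc_def[abs_def] by measurable

text \<open>The sinc function is the Fourier integral of the indicator of the interval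
  \<open>{- pi..pi}\<close>; this is why convolution with it leaves functions of this spectrum unchanged.\<close>

lemma nsinc_eq_integral:
  "complex_of_real (nsinc y) * (2 * pi) =
    (\<integral>s. exp (- (\<i> * complex_of_real s * complex_of_real y)) * indicator {- pi..pi} s \<partial>lborel)"
proof (cases "y = 0")
  case True
  have "(\<integral>s. indicator {- pi..pi} s \<partial>lborel) = complex_of_real (2 * pi)"
  proof -
    have "(\<integral>s. indicator {- pi..pi} s \<partial>lborel) = (\<integral>s. complex_of_real (indicator {- pi..pi} s) \<partial>lborel)"
      by (intro Bochner_Integration.integral_cong) (auto simp: indicator_def)
    then show ?thesis by simp
  qed
  with True show ?thesis by (simp add: nsinc_def)
next
  case False
  let ?E = "\<lambda>s. exp (- (\<i> * complex_of_real s * complex_of_real y))"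
  have "(\<integral>s. ?E s * indicator {- pi..pi} s \<partial>lborel) = (\<integral>s. indicator {- pi..pi} s *\<^sub>R ?E s \<partial>lborel)"
    by (intro Bochner_Integration.integral_cong) (auto simp: indicator_def)
  also have "\<dots> = \<i> / complex_of_real y * ?E pi - \<i> / complex_of_real y * ?E (- pi)"
  proof (rule integral_FTC_atLeastAtMost)
    show "((\<lambda>s. \<i> / complex_of_real y * ?E s) has_vector_derivative ?E s) (at s within {- pi..pi})" for s
      using False unfolding has_vector_derivative_complex_iff
      by (auto intro!: derivative_eq_intros simp: Re_exp Im_exp Re_divide_of_real Im_divide_of_real)
  qed (auto intro!: continuous_intros)
  also have "\<dots> = complex_of_real (2 * sin (pi * y) / y)"
    using False by (simp add: complex_eq_iff Re_exp Im_exp field_simps Re_divide_of_real Im_divide_of_real)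
  finally show ?thesis
    using False by (simp add: nsinc_def)
qed

lemma abs_nsinc_le_1: "\<bar>nsinc x\<bar> \<le> 1"
  using abs_sin_x_le_abs_x[of "pi * x"] by (simp add: nsinc_def abs_mult divide_le_eq_1)

text \<open>Not sharp: 1 suffices near the origin and \<open>1 / x\<^sup>2\<close> away from it, and both lie below
  a multiple of an integrable function on the whole line.\<close>

lemma nsinc_square_le: "(nsinc x)\<^sup>2 \<le> 2 * inverse (1 + x\<^sup>2)"
proof (cases "\<bar>x\<bar> \<le> 1")
  case True
  then have "x\<^sup>2 \<le> 1" "(nsinc x)\<^sup>2 \<le> 1"
    using abs_nsinc_le_1[of x] by (simp_all add: abs_square_le_1)
  moreover have "0 < 1 + x\<^sup>2" by (simp add: add_pos_nonneg)
  then have "1 \<le> 2 * inverse (1 + x\<^sup>2)" using \<open>x\<^sup>2 \<le> 1\<close> by (simp add: field_simps)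
  ultimately show ?thesis by linarith
next
  case False
  then have x: "1 \<le> x\<^sup>2" "x \<noteq> 0"
    by (auto simp: abs_square_le_1 intro: less_imp_le)
     (metis abs_square_le_1 linear)
  have "(nsinc x)\<^sup>2 = (sin (pi * x))\<^sup>2 / (pi\<^sup>2 * x\<^sup>2)"
    using x by (simp add: nsinc_def power_divide power_mult_distrib)
  also have "\<dots> \<le> 1 / (1 * x\<^sup>2)"
    using x pi_ge_two by (intro frac_le mult_right_mono) (auto simp: abs_square_le_1)
  also have "\<dots> \<le> 2 * inverse (1 + x\<^sup>2)"
    using x by (simp add: field_simps)
  finally show ?thesis .
qed

lemma integrable_nsinc_square: "integrable lborel (\<lambda>x. (nsinc x)\<^sup>2)"
proof (rule Bochner_Integration.integrable_bound)
  show "integrable lborel (\<lambda>x::real. 2 * inverse (1 + x\<^sup>2))"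
    by (intro integrable_mult_right integrable_lborel_inverse_1_plus_square)
qed (use nsinc_square_le in \<open>auto simp: abs_mult\<close>)

text \<open>Expanding sinc as a Fourier integral over \<open>{- pi..pi}\<close> and exchanging integrals
  leaves the inner integral of \<open>f x * exp (\<i> * s * x)\<close>, which is \<open>sqrt (2 * pi) * \<psi> s\<close> by
  inversion. As \<open>\<psi>\<close> vanishes off \<open>{- pi..pi}\<close>, the outer integral is again the transform of \<open>\<psi>\<close>.\<close>

theorem bandlimited_reproducing:
  assumes "f \<in> bandlimited_D"
  shows "(\<integral>x. complex_of_real (nsinc (t - x)) * f x \<partial>lborel) = f t"
proof -
  obtain \<psi> B C where f: "f = fourier_transform \<psi>" and cont: "continuous_on UNIV \<psi>"
    and supp: "\<And>s. s \<notin> {- pi..pi} \<Longrightarrow> \<psi> s = 0"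
    and bound: "\<And>s. cmod (\<psi> s) \<le> B"
    using bandlimited_D_elim[OF assms] by metis
  note int_f = bandlimited_D_integrable(2)[OF assms]
  have int_\<psi>: "integrable lborel \<psi>"
    using integrable_lborel_if_support_bounded[OF cont supp] .
  let ?E = "\<lambda>x s. exp (- (\<i> * complex_of_real s * complex_of_real (t - x)))"
  let ?I = "\<lambda>s. indicator {- pi..pi} s :: complex"
  have "(2 * pi) * (\<integral>x. complex_of_real (nsinc (t - x)) * f x \<partial>lborel) =
      (\<integral>x. f x * (complex_of_real (nsinc (t - x)) * (2 * pi)) \<partial>lborel)"
    by (subst integral_mult_right_zero[symmetric]) (simp add: mult_ac)
  also have "\<dots> = (\<integral>x. f x * (\<integral>s. ?E x s * ?I s \<partial>lborel) \<partial>lborel)"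
    by (simp only: nsinc_eq_integral)
  also have "\<dots> = (\<integral>s. (\<integral>x. f x * ?E x s \<partial>lborel) * ?I s \<partial>lborel)"
    by (intro Fubini_bounded_kernel int_f)
      (auto simp: sigma_finite_lborel simp del: of_real_diff
        intro!: integrable_real_indicator[THEN integrable_of_real, simplified of_real_indicator])
  also have "\<dots> = (\<integral>s. complex_of_real (sqrt (2 * pi)) *
       (\<psi> s * exp (- (\<i> * complex_of_real s * complex_of_real t))) \<partial>lborel)"
  proof (intro Bochner_Integration.integral_cong refl)
    fix s
    have "(\<integral>x. f x * ?E x s \<partial>lborel) = (\<integral>x. exp (- (\<i> * complex_of_real s * complex_of_real t)) *
        (f x * exp (\<i> * complex_of_real s * complex_of_real x)) \<partial>lborel)"
      by (intro Bochner_Integration.integral_cong refl)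
        (simp add: algebra_simps flip: exp_add)
    also have "\<dots> = exp (- (\<i> * complex_of_real s * complex_of_real t)) * (complex_of_real (sqrt (2 * pi)) * \<psi> s)"
      using fourier_inversion[OF int_\<psi> cont bound] int_f by (simp add: f)
    finally show "(\<integral>x. f x * ?E x s \<partial>lborel) * ?I s = complex_of_real (sqrt (2 * pi)) *
       (\<psi> s * exp (- (\<i> * complex_of_real s * complex_of_real t)))"
      by (cases "s \<in> {- pi..pi}") (simp_all add: supp mult_ac)
  qed
  also have "\<dots> = complex_of_real (sqrt (2 * pi)) * complex_of_real (sqrt (2 * pi)) * f t"
    by (simp add: f fourier_transform_def)
  also have "complex_of_real (sqrt (2 * pi)) * complex_of_real (sqrt (2 * pi)) = 2 * pi"
    by (simp flip: of_real_mult)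
  finally show ?thesis by simp
qed

section \<open>Averages of shifted sinc functions over a finite measure\<close>

text \<open>The Cauchy-Schwarz inequality against the constant 1.\<close>

lemma (in finite_measure) cmod_integral_square_le:
  assumes h: "integrable M h" "integrable M (\<lambda>u. (cmod (h u))\<^sup>2)"
  shows "(cmod (\<integral>u. h u \<partial>M))\<^sup>2 \<le> measure M (space M) * (\<integral>u. (cmod (h u))\<^sup>2 \<partial>M)"
proof -
  let ?c = "measure M (space M)" and ?I = "\<integral>u. cmod (h u) \<partial>M" and ?J = "\<integral>u. (cmod (h u))\<^sup>2 \<partial>M"
  have I: "(cmod (\<integral>u. h u \<partial>M))\<^sup>2 \<le> ?I\<^sup>2"
    using integral_norm_bound[of M h] by (intro power_mono) auto
  show ?thesis
  proof (cases "?c = 0")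
    case True
    then have "AE u in M. h u = 0"
      using emeasure_eq_measure[of "space M"] by (intro AE_I[of _ _ "space M"]) auto
    then have "(\<integral>u. h u \<partial>M) = 0"
      by (rule integral_eq_zero_AE)
    then show ?thesis using True by simp
  next
    case False
    then have c: "0 < ?c" by (simp add: zero_less_measure_iff)
    \<comment> \<open>the unnormalised variance of \<open>cmod (h u)\<close>, scaled by \<open>?c\<^sup>2\<close> to avoid dividing by the total mass\<close>
    have "0 \<le> (\<integral>u. (?c * cmod (h u) - ?I)\<^sup>2 \<partial>M)" by simp
    also have "\<dots> = (\<integral>u. ?c\<^sup>2 * (cmod (h u))\<^sup>2 - 2 * ?c * ?I * cmod (h u) + ?I\<^sup>2 \<partial>M)"
      by (simp add: power2_diff power_mult_distrib algebra_simps)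
    also have "\<dots> = ?c\<^sup>2 * ?J - 2 * ?c * ?I * ?I + ?c * ?I\<^sup>2"
      using h by simp
    also have "\<dots> = ?c * (?c * ?J - ?I\<^sup>2)"
      by (simp add: power2_eq_square algebra_simps)
    finally have "?I\<^sup>2 \<le> ?c * ?J"
      using c by (simp add: zero_le_mult_iff)
    with I show ?thesis by linarith
  qed
qed

text \<open>In the application \<open>M\<close> is the measure with density \<open>cmod (\<Phi> u)\<close>, \<open>c\<close> is the phase of
  \<open>\<Phi>\<close>, and \<open>r\<close> is the identity, viewed as a function on a space with a possibly larger
  \<open>\<sigma>\<close>-algebra than the Borel one.\<close>

lemma (in finite_measure) kernel_average_measurable:
  fixes c :: "'a \<Rightarrow> complex" and r :: "'a \<Rightarrow> real"
  assumes [measurable]: "c \<in> borel_measurable M" "r \<in> borel_measurable M"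
  shows "(\<lambda>(t, x). \<integral>u. c u * complex_of_real (nsinc (t / r u - x)) \<partial>M) \<in>
      borel_measurable (lborel \<Otimes>\<^sub>M lborel)"
  by measurable

text \<open>By Cauchy-Schwarz the square of the average is at most the total mass times the
  integral of the squares, and every translate of sinc has the same \<open>L\<^sup>2\<close> norm.\<close>

lemma (in finite_measure) kernel_average_square_integrable:
  fixes c :: "'a \<Rightarrow> complex" and r :: "'a \<Rightarrow> real"
  assumes [measurable]: "c \<in> borel_measurable M" "r \<in> borel_measurable M"
    and c_le: "\<And>u. cmod (c u) \<le> 1"
  shows "square_integrable lborel (\<lambda>x. \<integral>u. c u * complex_of_real (nsinc (t / r u - x)) \<partial>M)"
proof -
  interpret pair_sigma_finite lborel M
    by (simp add: pair_sigma_finite_def sigma_finite_lborel sigma_finite_measure_axioms)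
  interpret Q: pair_sigma_finite M lborel ..
  let ?K = "\<lambda>x. \<integral>u. c u * complex_of_real (nsinc (t / r u - x)) \<partial>M"
  let ?S = "\<lambda>x. \<integral>u. (nsinc (t / r u - x))\<^sup>2 \<partial>M"
  have translate: "integrable lborel (\<lambda>x. (nsinc (a - x))\<^sup>2)"
    "(\<integral>x. (nsinc (a - x))\<^sup>2 \<partial>lborel) = (\<integral>x. (nsinc x)\<^sup>2 \<partial>lborel)" for a
    using lborel_integrable_real_affine[OF integrable_nsinc_square, of "- 1" a]
      lborel_integral_real_affine[of "- 1" "\<lambda>x. (nsinc x)\<^sup>2" a] by simp_all
  have "integrable (M \<Otimes>\<^sub>M lborel) (\<lambda>(u, x). (nsinc (t / r u - x))\<^sup>2)"
    by (rule Q.Fubini_integrable) (auto simp: translate)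
  then have int_S: "integrable lborel ?S"
    by (rule Q.integrable_snd)
  have le: "(cmod (?K x))\<^sup>2 \<le> measure M (space M) * ?S x" for x
  proof -
    have sq_le: "(nsinc y)\<^sup>2 \<le> 1" for y
      using abs_nsinc_le_1 by (simp add: abs_square_le_1)
    have h_le: "(cmod (c u * complex_of_real (nsinc (t / r u - x))))\<^sup>2 \<le> (nsinc (t / r u - x))\<^sup>2" for u
      using c_le[of u] by (simp add: norm_mult power_mult_distrib mult_left_le_one_le power_le_one)
    have int_sq: "integrable M (\<lambda>u. (nsinc (t / r u - x))\<^sup>2)"
      by (rule integrable_const_bound[where B = 1]) (auto simp: sq_le)
    have h_le_1: "cmod (c u * complex_of_real (nsinc (t / r u - x))) \<le> 1" for u
      using c_le[of u] abs_nsinc_le_1 by (simp add: norm_mult mult_le_one)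
    have int_h: "integrable M (\<lambda>u. c u * complex_of_real (nsinc (t / r u - x)))"
      by (rule integrable_const_bound[where B = 1]) (use h_le_1 in auto)
    have int_h2: "integrable M (\<lambda>u. (cmod (c u * complex_of_real (nsinc (t / r u - x))))\<^sup>2)"
      by (rule Bochner_Integration.integrable_bound[OF int_sq]) (use h_le in auto)
    have "(cmod (?K x))\<^sup>2 \<le> measure M (space M) *
        (\<integral>u. (cmod (c u * complex_of_real (nsinc (t / r u - x))))\<^sup>2 \<partial>M)"
      using int_h int_h2 by (rule cmod_integral_square_le)
    also have "\<dots> \<le> measure M (space M) * ?S x"
      by (intro mult_left_mono integral_mono int_h2 int_sq h_le) auto
    finally show ?thesis .
  qed
  have "integrable lborel (\<lambda>x. (cmod (?K x))\<^sup>2)"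
  proof (rule Bochner_Integration.integrable_bound)
    show "integrable lborel (\<lambda>x. measure M (space M) * ?S x)"
      using int_S by simp
    show "AE x in lborel. norm ((cmod (?K x))\<^sup>2) \<le> norm (measure M (space M) * ?S x)"
      using le by (intro AE_I2) (simp add: order_trans[OF le abs_ge_self])
  qed measurable
  then show ?thesis
    by (simp add: square_integrable_def)
qed

text \<open>Replace \<open>f (t / r u)\<close> by its reproducing integral and exchange the integrals.\<close>

lemma (in finite_measure) kernel_average_reproducing:
  fixes c :: "'a \<Rightarrow> complex" and r :: "'a \<Rightarrow> real" and t :: real
  assumes [measurable]: "c \<in> borel_measurable M" "r \<in> borel_measurable M"
    and c_le: "\<And>u. cmod (c u) \<le> 1" and f: "f \<in> bandlimited_D"
  defines "K \<equiv> \<lambda>x. \<integral>u. c u * complex_of_real (nsinc (t / r u - x)) \<partial>M"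
  shows "integrable lborel (\<lambda>x. K x * f x)"
    and "(\<integral>u. c u * f (t / r u) \<partial>M) = (\<integral>x. K x * f x \<partial>lborel)"
proof -
  have int_c: "integrable M c"
    by (rule integrable_const_bound[where B = 1]) (use c_le in auto)
  have meas: "(\<lambda>(u, x). complex_of_real (nsinc (t / r u - x))) \<in> borel_measurable (M \<Otimes>\<^sub>M lborel)"
    by measurable
  have le: "cmod (complex_of_real (nsinc (t / r u - x))) \<le> 1" for u x
    using abs_nsinc_le_1 by simp
  note Fub = Fubini_bounded_kernel[OF sigma_finite_measure_axioms sigma_finite_lborel int_c
      bandlimited_D_integrable(2)[OF f] meas le]
  show "integrable lborel (\<lambda>x. K x * f x)"
    unfolding K_def by (rule Fub(2))
  show "(\<integral>u. c u * f (t / r u) \<partial>M) = (\<integral>x. K x * f x \<partial>lborel)"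
    using Fub(1) by (simp add: K_def bandlimited_reproducing[OF f])
qed

section \<open>The Hausdorff operator and its kernel\<close>

text \<open>Polar decomposition \<open>\<Phi> = cmod \<Phi> * sgn \<Phi>\<close>, with the modulus absorbed into the
  measure. For integrable \<open>\<Phi>\<close> the new measure is finite
  (\<open>finite_measure_density_norm\<close>), so Fubini's theorem becomes applicable although \<open>M\<close> may fail to be \<open>\<sigma>\<close>-finite.\<close>

lemma integral_density_norm:
  fixes \<Phi> h :: "'a \<Rightarrow> complex"
  assumes [measurable]: "\<Phi> \<in> borel_measurable M" "h \<in> borel_measurable M"
  shows "(\<integral>u. \<Phi> u * h u \<partial>M) = (\<integral>u. sgn (\<Phi> u) * h u \<partial>density M (\<lambda>u. cmod (\<Phi> u)))"
proof -
  have "cmod z *\<^sub>R (sgn z * w) = z * w" for z w :: complex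
    by (cases "z = 0") (simp_all add: sgn_div_norm)
  then show ?thesis
    by (subst integral_density) auto
qed

lemma finite_measure_density_norm:
  fixes \<Phi> :: "'a \<Rightarrow> complex"
  assumes "integrable M \<Phi>"
  shows "finite_measure (density M (\<lambda>u. cmod (\<Phi> u)))"
proof (rule finite_measureI)
  have [measurable]: "\<Phi> \<in> borel_measurable M"
    using assms by auto
  have "emeasure (density M (\<lambda>u. cmod (\<Phi> u))) (space M) = (\<integral>\<^sup>+u. cmod (\<Phi> u) \<partial>M)"
    by (subst emeasure_density) (auto intro!: nn_integral_cong)
  then show "emeasure (density M (\<lambda>u. cmod (\<Phi> u))) (space (density M (\<lambda>u. cmod (\<Phi> u)))) \<noteq> \<infinity>"
    using assms by (simp add: integrable_iff_bounded)
qed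

lemma bandlimited_D_lincomb:
  assumes "f \<in> bandlimited_D" "g \<in> bandlimited_D"
  shows "(\<lambda>x. a * f x + b * g x) \<in> bandlimited_D"
proof -
  obtain \<psi> where f: "f = fourier_transform \<psi>" and C2_\<psi>: "C2_on_reals \<psi>"
    and cl_\<psi>: "closure {s. \<psi> s \<noteq> 0} \<subseteq> {- pi..pi}"
    using assms(1) unfolding bandlimited_D_def by blast
  obtain \<theta> where g: "g = fourier_transform \<theta>" and C2_\<theta>: "C2_on_reals \<theta>"
    and cl_\<theta>: "closure {s. \<theta> s \<noteq> 0} \<subseteq> {- pi..pi}"
    using assms(2) unfolding bandlimited_D_def by blast
  have int: "integrable lborel (\<lambda>s. \<phi> s * exp (- (\<i> * complex_of_real s * complex_of_real x)))"
    if C2: "C2_on_reals \<phi>" and cl: "closure {s. \<phi> s \<noteq> 0} \<subseteq> {- pi..pi}" for \<phi> x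
  proof (rule integrable_lborel_if_support_bounded[of _ "- pi" pi])
    obtain \<phi>' where "\<And>s. (\<phi> has_vector_derivative \<phi>' s) (at s)"
      using C2 unfolding C2_on_reals_def by blast
    then have "continuous_on UNIV \<phi>"
      by (auto intro!: continuous_at_imp_continuous_on has_vector_derivative_continuous)
    then show "continuous_on UNIV (\<lambda>s. \<phi> s * exp (- (\<i> * complex_of_real s * complex_of_real x)))"
      by (intro continuous_intros)
    show "\<phi> s * exp (- (\<i> * complex_of_real s * complex_of_real x)) = 0" if "s \<notin> {- pi..pi}" for s
      using cl closure_subset[of "{s. \<phi> s \<noteq> 0}"] that by fastforce
  qed
  have "(\<lambda>x. a * f x + b * g x) = fourier_transform (\<lambda>s. a * \<psi> s + b * \<theta> s)"
    unfolding f g fourier_transform_def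
    using int[OF C2_\<psi> cl_\<psi>] int[OF C2_\<theta> cl_\<theta>]
    by (simp add: distrib_right distrib_left mult_ac fun_eq_iff)
  moreover have "C2_on_reals (\<lambda>s. a * \<psi> s + b * \<theta> s)"
  proof -
    obtain \<psi>' \<theta>' where "\<And>s. (\<psi> has_vector_derivative \<psi>' s) (at s)" "\<psi>' C1_differentiable_on UNIV"
      "\<And>s. (\<theta> has_vector_derivative \<theta>' s) (at s)" "\<theta>' C1_differentiable_on UNIV"
      using C2_\<psi> C2_\<theta> unfolding C2_on_reals_def by blast
    then show ?thesis unfolding C2_on_reals_def
      by (intro exI[of _ "\<lambda>s. a * \<psi>' s + b * \<theta>' s"])
        (auto intro!: C1_differentiable_on_add C1_differentiable_on_mult has_vector_derivative_add
           has_vector_derivative_mult_right)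
  qed
  moreover have "closure {s. a * \<psi> s + b * \<theta> s \<noteq> 0} \<subseteq> {- pi..pi}"
  proof -
    have "closure {s. a * \<psi> s + b * \<theta> s \<noteq> 0} \<subseteq> closure ({s. \<psi> s \<noteq> 0} \<union> {s. \<theta> s \<noteq> 0})"
      by (intro closure_mono) auto
    also have "\<dots> \<subseteq> {- pi..pi}"
      using cl_\<psi> cl_\<theta> by simp
    finally show ?thesis .
  qed
  ultimately show ?thesis
    unfolding bandlimited_D_def by blast
qed

lemma zero_in_bandlimited_D: "(\<lambda>_. 0) \<in> bandlimited_D"
proof -
  have "(\<lambda>_. 0) = fourier_transform (\<lambda>_. 0)"
    by (simp add: fourier_transform_def fun_eq_iff)
  moreover have "C2_on_reals (\<lambda>_. 0)"
    unfolding C2_on_reals_def by (intro exI[of _ "\<lambda>_. 0"]) auto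
  ultimately show ?thesis
    unfolding bandlimited_D_def by (intro CollectI exI[of _ "\<lambda>_. 0"]) auto
qed

lemma square_integrable_lincomb:
  assumes f: "square_integrable M f" and g: "square_integrable M g"
  shows "square_integrable M (\<lambda>x. a * f x + b * g x)"
proof -
  have [measurable]: "f \<in> borel_measurable M" "g \<in> borel_measurable M"
    using f g by (auto simp: square_integrable_def)
  have "integrable M (\<lambda>x. (cmod (a * f x + b * g x))\<^sup>2)"
  proof (rule Bochner_Integration.integrable_bound)
    show "integrable M (\<lambda>x. 2 * (cmod a)\<^sup>2 * (cmod (f x))\<^sup>2 + 2 * (cmod b)\<^sup>2 * (cmod (g x))\<^sup>2)"
      using f g by (simp add: square_integrable_def)
    have "(cmod (z + w))\<^sup>2 \<le> 2 * (cmod z)\<^sup>2 + 2 * (cmod w)\<^sup>2" for z w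
    proof -
      have "(cmod (z + w))\<^sup>2 \<le> (cmod z + cmod w)\<^sup>2"
        by (intro power_mono norm_triangle_ineq) auto
      also have "\<dots> \<le> 2 * (cmod z)\<^sup>2 + 2 * (cmod w)\<^sup>2"
        using sum_squares_bound[of "cmod z" "cmod w"] by (simp add: power2_sum)
      finally show ?thesis .
    qed
    from this[of "a * f x" "b * g x" for x]
    show "AE x in M. norm ((cmod (a * f x + b * g x))\<^sup>2) \<le>
        norm (2 * (cmod a)\<^sup>2 * (cmod (f x))\<^sup>2 + 2 * (cmod b)\<^sup>2 * (cmod (g x))\<^sup>2)"
      by (intro AE_I2) (simp add: norm_mult power_mult_distrib mult.assoc)
  qed measurable
  then show ?thesis
    by (simp add: square_integrable_def)
qed

text \<open>What remains is to pass to the finite measure with density \<open>cmod (\<Phi> u)\<close> and to check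
  that the Hausdorff operator is well defined on almost-everywhere classes. For the latter, its
  kernel representation depends on \<open>f\<close> only up to a null set.\<close>

theorem theorem12:
  fixes \<mu> :: "real measure" and \<Phi> :: "real \<Rightarrow> complex"
  assumes "regular_borel_measure_on {0<..} \<mu>"
    and "integrable (completion \<mu>) \<Phi>"
  shows "carleman_kernel lborel lborel (hausdorff_kernel \<Phi> \<mu>) \<and>
    (\<forall>t x. integrable (completion \<mu>) (\<lambda>u. \<Phi> u * complex_of_real (nsinc (t / u - x)))) \<and>
    (\<forall>f\<in>bandlimited_D. square_integrable lborel f \<and>
       (\<forall>t. integrable (completion \<mu>) (\<lambda>u. \<Phi> u * f (t / u)) \<and>
            integrable lborel (\<lambda>x. hausdorff_kernel \<Phi> \<mu> t x * f x) \<and>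
            hausdorff_op \<Phi> \<mu> f t = (LINT x|lborel. hausdorff_kernel \<Phi> \<mu> t x * f x))) \<and>
    carleman_operator lborel lborel
      {f\<in>bandlimited_D. square_integrable lborel (hausdorff_op \<Phi> \<mu> f)} (hausdorff_op \<Phi> \<mu>)"
proof -
  let ?M = "completion \<mu>" and ?N = "density (completion \<mu>) (\<lambda>u. cmod (\<Phi> u))"
  let ?c = "\<lambda>u. sgn (\<Phi> u)" and ?K = "hausdorff_kernel \<Phi> \<mu>" and ?H = "hausdorff_op \<Phi> \<mu>"
  let ?S = "{f\<in>bandlimited_D. square_integrable lborel (?H f)}"
  have "sets \<mu> = sets (restrict_space borel {0<..})"
    using assms(1) by (simp add: regular_borel_measure_on_def)
  then have "(\<lambda>u. u) \<in> borel_measurable \<mu>"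
    by (subst measurable_cong_sets[OF _ refl]) (auto intro: measurable_restrict_space1)
  \<comment> \<open>the identity is Borel measurable on the half-line, hence so is \<open>u \<mapsto> t / u\<close> for the completion\<close>
  then have id[measurable]: "(\<lambda>u. u) \<in> borel_measurable ?M"
    by (rule measurable_completion)
  have \<Phi>[measurable]: "\<Phi> \<in> borel_measurable ?M"
    using assms(2) by auto
  interpret N: finite_measure ?N
    by (rule finite_measure_density_norm[OF assms(2)])
  have c: "?c \<in> borel_measurable ?N" and id_N: "(\<lambda>u. u) \<in> borel_measurable ?N"
    by simp_all
  have c_le: "cmod (?c u) \<le> 1" for u
    by (simp add: norm_sgn)
  have sinc_meas: "(\<lambda>u. complex_of_real (nsinc (t / u - x))) \<in> borel_measurable ?M" for t x
    by measurable
  have K: "?K t x = (\<integral>u. ?c u * complex_of_real (nsinc (t / u - x)) \<partial>?N)" for t x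
    unfolding hausdorff_kernel_def by (rule integral_density_norm[OF \<Phi> sinc_meas])
  have f_meas: "(\<lambda>u. f (t / u)) \<in> borel_measurable ?M" if "f \<in> bandlimited_D" for f t
    using bandlimited_D_integrable(1)[OF that] by measurable
  have H: "?H f t = (\<integral>u. ?c u * f (t / u) \<partial>?N)" if "f \<in> bandlimited_D" for f t
    unfolding hausdorff_op_def by (rule integral_density_norm[OF \<Phi> f_meas[OF that]])
  have bounded_mult: "integrable ?M (\<lambda>u. \<Phi> u * h u)"
    if [measurable]: "h \<in> borel_measurable ?M" and h_le: "\<And>u. cmod (h u) \<le> B" for h B
  proof (rule Bochner_Integration.integrable_bound)
    show "integrable ?M (\<lambda>u. of_real B * \<Phi> u)" using assms(2) by simp
    show "AE u in ?M. norm (\<Phi> u * h u) \<le> norm (of_real B * \<Phi> u)"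
    proof (rule AE_I2)
      fix u
      have "cmod (h u) \<le> \<bar>B\<bar>" using h_le[of u] by linarith
      then show "norm (\<Phi> u * h u) \<le> norm (of_real B * \<Phi> u)"
        by (simp add: norm_mult mult.commute[of _ "cmod (\<Phi> u)"] mult_left_mono)
    qed
  qed measurable
  have kernel: "carleman_kernel lborel lborel ?K"
    unfolding carleman_kernel_def K[abs_def]
    using N.kernel_average_measurable[OF c id_N] N.kernel_average_square_integrable[OF c id_N c_le]
    by simp
  have int_K: "integrable ?M (\<lambda>u. \<Phi> u * complex_of_real (nsinc (t / u - x)))" for t x
    using abs_nsinc_le_1 by (intro bounded_mult[of _ 1] sinc_meas) simp
  have int_H: "integrable ?M (\<lambda>u. \<Phi> u * f (t / u))" if f: "f \<in> bandlimited_D" for f t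
  proof -
    obtain B where "\<And>x. cmod (f x) \<le> B"
      using bandlimited_D_integrable(4)[OF f] by blast
    then show ?thesis by (intro bounded_mult[of _ B] f_meas[OF f])
  qed
  have H_eq: "integrable lborel (\<lambda>x. ?K t x * f x)" "?H f t = (\<integral>x. ?K t x * f x \<partial>lborel)"
    if f: "f \<in> bandlimited_D" for f t
    unfolding K H[OF f] using N.kernel_average_reproducing[OF c id_N c_le f, of t] by auto
  have H_lin: "?H (\<lambda>x. a * f x + b * g x) = (\<lambda>t. a * ?H f t + b * ?H g t)"
    if "f \<in> bandlimited_D" "g \<in> bandlimited_D" for f g a b
  proof
    fix t
    have "?H (\<lambda>x. a * f x + b * g x) t =
        (\<integral>u. a * (\<Phi> u * f (t / u)) + b * (\<Phi> u * g (t / u)) \<partial>?M)"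
      unfolding hausdorff_op_def by (simp add: algebra_simps)
    also have "\<dots> = a * ?H f t + b * ?H g t"
      using int_H[OF that(1), of t] int_H[OF that(2), of t] by (simp add: hausdorff_op_def)
    finally show "?H (\<lambda>x. a * f x + b * g x) t = a * ?H f t + b * ?H g t" .
  qed
  have H_zero: "?H (\<lambda>_. 0) = (\<lambda>_. 0)"
    by (simp add: hausdorff_op_def fun_eq_iff)
  have H_cong: "?H f = ?H g" if f: "f \<in> bandlimited_D" and g: "g \<in> bandlimited_D"
    and ae: "AE x in lborel. f x = g x" for f g
  proof
    fix t
    have "(\<integral>x. ?K t x * f x \<partial>lborel) = (\<integral>x. ?K t x * g x \<partial>lborel)"
      using ae H_eq(1)[OF f, of t] H_eq(1)[OF g, of t]
      by (intro integral_cong_AE) (auto intro: borel_measurable_integrable)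
    then show "?H f t = ?H g t"
      by (simp add: H_eq(2) f g)
  qed
  have "L2_operator lborel lborel ?S ?H"
    unfolding L2_operator_def
  proof (intro conjI ballI allI impI)
    show "(\<lambda>_. 0) \<in> ?S"
      using zero_in_bandlimited_D by (simp add: H_zero square_integrable_def)
    fix f assume f: "f \<in> ?S"
    then show "square_integrable lborel f" "square_integrable lborel (?H f)"
      using bandlimited_D_integrable(3) by auto
    fix g assume g: "g \<in> ?S"
    show "(\<lambda>x. a * f x + b * g x) \<in> ?S" for a b
      using f g by (simp add: bandlimited_D_lincomb H_lin square_integrable_lincomb)
    show "AE y in lborel. ?H (\<lambda>x. a * f x + b * g x) y = a * ?H f y + b * ?H g y" for a b
      using f g by (simp add: H_lin)
    show "AE y in lborel. ?H f y = ?H g y" if "AE x in lborel. f x = g x"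
      using H_cong[of f g] f g that by simp
  qed
  then have "carleman_operator lborel lborel ?S ?H"
    unfolding carleman_operator_def using kernel H_eq(2) by (intro conjI exI[of _ ?K]) auto
  with kernel int_K int_H H_eq bandlimited_D_integrable(3) show ?thesis
    by blast
qed

end
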